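(* For every integer $n\ge1$ there is a bijection $\varphi^{(B)}:\mathcal{A}^{(H)}_n\to\mathcal{RS}^{(B)}_{n-1}$ such that $\mathrm{Last}(\sigma)-1=\mathrm{Last}(\varphi^{(B)}(\sigma))$ for all $\sigma\in\mathcal{A}^{(H)}_n$. In particular, for each $k$, $\varphi^{(B)}$ restricts to a bijection from the set of elements of $\mathcal{A}^{(H)}_n$ with last entry $k$ onto the set of elements of $\mathcal{RS}^{(B)}_{n-1}$ with last entry $k-1$.
   Context: A signed permutation of $[n]$ is a sequence $\pi=\pi_1\cdots\pi_n$ of elements of $\{\pm1,\dots,\pm n\}$ such that $|\pi_1|\cdots|\pi_n|$ is a permutation of $[n]$; $\mathrm{Last}(\pi)=\pi_n$. For an ordinary permutation $\tau$ of $[n]$, $\tau_{[k]}$ is the subword of letters $1,\dots,k$ in order of appearance; a double descent is three consecutive letters $a>b>c$; ending with an ascent means the last two letters $x,y$ satisfy $x<y$. $\tau$ is André if for all $k$, $\tau_{[k]}$ has no double descents and ends with an ascent (vacuous for length 1); $\tau$ is Simsun if for all $k$, $\tau_{[k]}$ has no double descents. $\mathcal{A}^{(H)}_n$ (Hetyei's signed André permutations) is the set of signed permutations $\pi$ of $[n]$ such that $|\pi_1|\cdots|\pi_n|$ is an André permutation and $\pi_i>0$ whenever $|\pi_i|=\min\{|\pi_i|,|\pi_{i+1}|,\dots,|\pi_n|\}$. $\mathcal{RS}^{(B)}_n$ (signed Simsun permutations) is the set of signed permutations $\pi$ of $[n]$ such that $|\pi_1|\cdots|\pi_n|$ is a Simsun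 permutation and $\pi_i>0$ whenever $|\pi_i|=\min\{|\pi_i|,|\pi_{i+1}|,\dots,|\pi_n|\}$. *)

theory Defs
  imports Main "HOL-Combinatorics.Multiset_Permutations"
begin

text \<open>Words are lists, with letters indexed from \<open>0\<close>. Permutations of \<open>[n]\<close> in one-line
  notation are the elements of \<^term>\<open>permutations_of_set {1..n}\<close>.\<close>

definition subword :: "nat list \<Rightarrow> nat \<Rightarrow> nat list" where
  "subword \<tau> k = filter (\<lambda>x. x \<le> k) \<tau>"

definition has_double_descent :: "nat list \<Rightarrow> bool" where
  "has_double_descent \<tau> \<longleftrightarrow>
     (\<exists>i. i + 2 < length \<tau> \<and> \<tau> ! i > \<tau> ! (i + 1) \<and> \<tau> ! (i + 1) > \<tau> ! (i + 2))"

text \<open>Vacuously true for words of length at most 1.\<close>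

definition ends_with_ascent :: "nat list \<Rightarrow> bool" where
  "ends_with_ascent \<tau> \<longleftrightarrow>
     (length \<tau> \<ge> 2 \<longrightarrow> \<tau> ! (length \<tau> - 2) < \<tau> ! (length \<tau> - 1))"

definition andre_perms :: "nat \<Rightarrow> nat list set" where
  "andre_perms n = {\<tau> \<in> permutations_of_set {1..n}.
     \<forall>k\<in>{1..n}. \<not> has_double_descent (subword \<tau> k) \<and> ends_with_ascent (subword \<tau> k)}"

definition simsun_perms :: "nat \<Rightarrow> nat list set" where
  "simsun_perms n = {\<tau> \<in> permutations_of_set {1..n}.
     \<forall>k\<in>{1..n}. \<not> has_double_descent (subword \<tau> k)}"

definition abs_word :: "int list \<Rightarrow> nat list" where
  "abs_word \<pi> = map (\<lambda>x. nat \<bar>x\<bar>) \<pi>"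

definition signed_perms :: "nat \<Rightarrow> int list set" where
  "signed_perms n = {\<pi>. abs_word \<pi> \<in> permutations_of_set {1..n}}"

definition positive_at_suffix_minima :: "int list \<Rightarrow> bool" where
  "positive_at_suffix_minima \<pi> \<longleftrightarrow>
     (\<forall>i<length \<pi>. \<bar>\<pi> ! i\<bar> = Min ((\<lambda>j. \<bar>\<pi> ! j\<bar>) ` {i..<length \<pi>}) \<longrightarrow> \<pi> ! i > 0)"

definition hetyei_andre :: "nat \<Rightarrow> int list set" where
  "hetyei_andre n =
     {\<pi> \<in> signed_perms n. abs_word \<pi> \<in> andre_perms n \<and> positive_at_suffix_minima \<pi>}"

definition signed_simsun :: "nat \<Rightarrow> int list set" where
  "signed_simsun n =
     {\<pi> \<in> signed_perms n. abs_word \<pi> \<in> simsun_perms n \<and> positive_at_suffix_minima \<pi>}"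

text \<open>By convention the empty word, the unique signed permutation of the empty set,
  has last letter \<open>0\<close>.\<close>

definition Last :: "int list \<Rightarrow> int" where
  "Last \<pi> = (if \<pi> = [] then 0 else last \<pi>)"

end

theory Submission
  imports Defs
begin

text \<open>Grow the words by inserting the new largest letter, with a sign. At the end it must be
  positive and becomes the last letter; elsewhere the sign is free, the last letter and the other
  suffix minima are unaffected. The letter may be inserted before any letter that is neither a
  descent top nor, for Andre words, the last one. If the word has \<open>d\<close> descents, and its length is \<open>m\<close>
  (Simsun) or \<open>m + 1\<close> (Andre), there are \<open>m - d\<close> such sites: \<open>d\<close> of them, inside a descent, keep
  the number of descents and the other \<open>m - 2d\<close> raise it by one. So the numbers of children with
  given descents and last letter (shifted by one for Andre words) agree, and a bijection
  preserving both statistics exists by induction on \<open>m\<close>.\<close>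

section \<open>Signed words grown by insertion, and the statistics followed\<close>

definition ins :: "nat \<Rightarrow> 'a \<Rightarrow> 'a list \<Rightarrow> 'a list" where
  "ins i x w = take i w @ x # drop i w"

definition descents :: "nat list \<Rightarrow> nat set" where
  "descents w = {i. Suc i < length w \<and> w ! i > w ! Suc i}"

text \<open>For words with distinct letters, \<open>e = 0\<close> says that there is no double descent, and \<open>e = 1\<close>
  additionally that the word does not end with a descent.\<close>

definition good :: "nat \<Rightarrow> nat list \<Rightarrow> bool" where
  "good e w \<longleftrightarrow> (\<forall>i\<in>descents w. Suc i \<notin> descents w \<and> Suc i + e < length w)"

text \<open>One family covers both sides: \<open>e = 0\<close> gives the signed Simsun permutations
  and \<open>e = 1\<close> Hetyei's signed Andre permutations, so the insertion analysis is done
  only once.\<close>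

definition good_signed_perms :: "nat \<Rightarrow> nat \<Rightarrow> int list set" where
  "good_signed_perms e n = {\<pi>. abs_word \<pi> \<in> permutations_of_set {1..n} \<and>
     (\<forall>k\<in>{1..n}. good e (subword (abs_word \<pi>) k)) \<and> positive_at_suffix_minima \<pi>}"

text \<open>The end of the word is left out: appending is always possible but forces a positive
  sign, so it is counted apart.\<close>

definition sites :: "nat \<Rightarrow> nat list \<Rightarrow> nat set" where
  "sites e w = {..<length w - e} - descents w"

text \<open>The number of descents is tracked because it determines how many children a word has;
  the shift by \<open>e\<close> makes the last letters of the two families agree.\<close>

definition stat :: "nat \<Rightarrow> int list \<Rightarrow> nat \<times> int" where
  "stat e \<pi> = (card (descents (abs_word \<pi>)), Last \<pi> - int e)"

section \<open>Elementary facts on insertion\<close>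

lemma length_ins [simp]: "length (ins i x w) = Suc (length w)"
  by (simp add: ins_def)

lemma set_ins [simp]: "set (ins i x w) = insert x (set w)"
  by (metis Un_insert_right append_take_drop_id ins_def list.simps(15) set_append)

lemma distinct_ins [simp]: "distinct (ins i x w) \<longleftrightarrow> x \<notin> set w \<and> distinct w"
proof -
  have "distinct (u @ x # v) \<longleftrightarrow> x \<notin> set (u @ v) \<and> distinct (u @ v)" for u v
    by auto
  from this[of "take i w" "drop i w"] show ?thesis
    by (simp add: ins_def del: distinct_append set_append)
qed

lemma nth_ins:
  "i \<le> length w \<Longrightarrow> j \<le> length w \<Longrightarrow>
   ins i x w ! j = (if j < i then w ! j else if j = i then x else w ! (j - 1))"
  by (auto simp: ins_def nth_append nth_Cons' min_def)

lemma ins_length [simp]: "ins (length w) x w = w @ [x]"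
  by (simp add: ins_def)

lemma filter_ins:
  "filter P (ins i x w) = (if P x then ins (length (filter P (take i w))) x (filter P w) else filter P w)"
proof -
  have "filter P w = filter P (take i w) @ filter P (drop i w)"
    by (metis append_take_drop_id filter_append)
  then show ?thesis by (simp add: ins_def)
qed

lemma abs_word_ins: "abs_word (ins i x \<pi>) = ins i (nat \<bar>x\<bar>) (abs_word \<pi>)"
  by (simp add: abs_word_def ins_def take_map drop_map)

lemma length_abs_word [simp]: "length (abs_word \<pi>) = length \<pi>"
  by (simp add: abs_word_def)

section \<open>Descents after inserting a new maximum\<close>

lemma finite_descents [simp]: "finite (descents w)"
  by (rule finite_subset[of _ "{..<length w}"]) (auto simp: descents_def)

lemma descents_snoc:
  assumes "\<And>y. y \<in> set w \<Longrightarrow> y < x"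
  shows "descents (w @ [x]) = descents w"
proof -
  have "j \<in> descents (w @ [x]) \<longleftrightarrow> j \<in> descents w" for j
  proof (cases "Suc j = length w")
    case True
    then have "w ! j < x" using assms by simp
    then show ?thesis using True by (simp add: descents_def nth_append)
  qed (auto simp: descents_def nth_append)
  then show ?thesis by blast
qed

text \<open>The step into the maximum \<open>x\<close> is an ascent and the step out of it a
  descent. So a descent at \<open>i - 1\<close> is lost, one at \<open>i\<close> appears, and those
  from \<open>i\<close> on move one place to the right.\<close>

lemma mem_descents_ins:
  assumes "\<And>y. y \<in> set w \<Longrightarrow> y < x" and i: "i < length w"
  shows "j \<in> descents (ins i x w) \<longleftrightarrow>
    j < i \<and> Suc j \<noteq> i \<and> j \<in> descents w \<or> j = i \<or> i < j \<and> j - 1 \<in> descents w"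
proof -
  have lt: "w ! l < x" if "l < length w" for l using assms that by simp
  show ?thesis
  proof (cases "Suc j < Suc (length w)")
    case True
    then have eq: "j \<in> descents (ins i x w) \<longleftrightarrow>
      (if Suc j < i then w ! Suc j else if Suc j = i then x else w ! j)
       < (if j < i then w ! j else if j = i then x else w ! (j - 1))"
      using i by (simp add: descents_def nth_ins)
    consider "Suc j < i" | "Suc j = i" | "j = i" | "i < j" by linarith
    then show ?thesis
    proof cases
      case 2
      then have "w ! j < x" using lt i by simp
      then show ?thesis using 2 eq by simp
    next
      case 4
      then obtain l where "j = Suc l" by (cases j) auto
      then show ?thesis using 4 eq True by (auto simp: descents_def)
    qed (use eq True i lt in \<open>auto simp: descents_def\<close>)
  next
    case False
    then show ?thesis using i by (auto simp: descents_def)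
  qed
qed

lemma card_descents_ins:
  assumes "\<And>y. y \<in> set w \<Longrightarrow> y < x" and i: "i < length w"
  shows "card (descents (ins i x w)) =
    (if i \<in> Suc ` descents w then card (descents w) else Suc (card (descents w)))"
proof -
  \<comment> \<open>\<open>f\<close> renumbers the descents that survive, all but the possible one
    at \<open>i - 1\<close>.\<close>
  define f where "f j = (if j < i then j else Suc j)" for j
  let ?D = "{j \<in> descents w. Suc j \<noteq> i}"
  have "descents (ins i x w) = insert i (f ` ?D)"
  proof (rule set_eqI)
    fix j
    have "j \<in> f ` ?D \<longleftrightarrow> j < i \<and> Suc j \<noteq> i \<and> j \<in> descents w \<or> i < j \<and> j - 1 \<in> descents w"
    proof
      assume "j < i \<and> Suc j \<noteq> i \<and> j \<in> descents w \<or> i < j \<and> j - 1 \<in> descents w"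
      then show "j \<in> f ` ?D"
      proof
        assume "j < i \<and> Suc j \<noteq> i \<and> j \<in> descents w"
        then show ?thesis by (intro image_eqI[of _ _ j]) (auto simp: f_def)
      next
        assume "i < j \<and> j - 1 \<in> descents w"
        then show ?thesis by (intro image_eqI[of _ _ "j - 1"]) (auto simp: f_def)
      qed
    qed (auto simp: f_def split: if_splits)
    then show "j \<in> descents (ins i x w) \<longleftrightarrow> j \<in> insert i (f ` ?D)"
      using mem_descents_ins[OF assms, of j] by blast
  qed
  moreover have "i \<notin> f ` ?D" by (auto simp: f_def)
  moreover have "inj_on f ?D" by (auto simp: f_def inj_on_def split: if_splits)
  ultimately have card: "card (descents (ins i x w)) = Suc (card ?D)"
    by (simp add: card_image)
  show ?thesis
  proof (cases "i \<in> Suc ` descents w")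
    case True
    then obtain l where l: "l \<in> descents w" "i = Suc l" by blast
    then have "?D = descents w - {l}" by auto
    then show ?thesis using card l by (metis True card_Suc_Diff1 finite_descents)
  next
    case False
    then have "?D = descents w" by auto
    then show ?thesis using card False by simp
  qed
qed

lemma good_snoc:
  assumes "\<And>y. y \<in> set w \<Longrightarrow> y < x" and "good e w"
  shows "good e (w @ [x])"
proof -
  have "descents (w @ [x]) = descents w" using assms(1) by (rule descents_snoc)
  then show ?thesis using assms(2) by (auto simp: good_def)
qed

text \<open>All descents other than the new one at \<open>i\<close> inherit their conditions from
  \<open>w\<close>. At \<open>i\<close>, no double descent means that \<open>i\<close> is not a
  descent of \<open>w\<close>, and the distance from the end means
  \<open>i < length w - e\<close>.\<close>

lemma good_ins_iff:
  assumes x: "\<And>y. y \<in> set w \<Longrightarrow> y < x" and i: "i < length w" and good: "good e w"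
  shows "good e (ins i x w) \<longleftrightarrow> i \<in> sites e w"
proof
  assume "good e (ins i x w)"
  then show "i \<in> sites e w"
    using mem_descents_ins[OF x i, of i] mem_descents_ins[OF x i, of "Suc i"]
    by (auto simp: good_def sites_def)
next
  assume site: "i \<in> sites e w"
  show "good e (ins i x w)"
    unfolding good_def
  proof (intro ballI conjI)
    fix j assume "j \<in> descents (ins i x w)"
    then consider "j < i" "Suc j \<noteq> i" "j \<in> descents w" | "j = i" | "i < j" "j - 1 \<in> descents w"
      using mem_descents_ins[OF x i, of j] by blast
    then have "Suc j \<notin> descents (ins i x w) \<and> Suc j + e < Suc (length w)"
      using mem_descents_ins[OF x i, of "Suc j"] site good
      by cases (force simp: good_def sites_def)+
    then show "Suc j \<notin> descents (ins i x w)" "Suc j + e < length (ins i x w)" by simp_all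
  qed
qed

text \<open>Descents are never adjacent, so the position after a descent top is itself a site. Of
  the \<open>length w - e\<close> candidates, one copy of the descents is forbidden and a second
  copy lies inside descents.\<close>

lemma card_sites:
  assumes "good e w"
  shows "Suc ` descents w \<subseteq> sites e w"
    and "card (sites e w - Suc ` descents w) = length w - e - 2 * card (descents w)"
proof -
  show sub: "Suc ` descents w \<subseteq> sites e w"
    using assms by (auto simp: good_def sites_def)
  have "descents w \<subseteq> {..<length w - e}"
    using assms by (auto simp: good_def)
  then have "card (sites e w) = length w - e - card (descents w)"
    by (simp add: sites_def card_Diff_subset)
  then show "card (sites e w - Suc ` descents w) = length w - e - 2 * card (descents w)"
    using sub by (simp add: card_Diff_subset card_image)
qed

section \<open>Signs at suffix minima\<close>

lemma positive_at_suffix_minima_Nil [simp]: "positive_at_suffix_minima []"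
  by (simp add: positive_at_suffix_minima_def)

text \<open>Turns the indexed minima into a recursion on the list: only the condition at the head
  involves the head, and the later suffixes are those of the tail.\<close>

lemma positive_at_suffix_minima_Cons:
  "positive_at_suffix_minima (a # \<pi>) \<longleftrightarrow>
   ((\<forall>y\<in>set \<pi>. \<bar>a\<bar> \<le> \<bar>y\<bar>) \<longrightarrow> a > 0) \<and> positive_at_suffix_minima \<pi>"
proof -
  have "(\<lambda>j. \<bar>(a # \<pi>) ! j\<bar>) ` {0..<length (a # \<pi>)} = abs ` ((!) (a # \<pi>) ` {0..<length (a # \<pi>)})"
    by (rule image_image[symmetric])
  then have "(\<lambda>j. \<bar>(a # \<pi>) ! j\<bar>) ` {0..<Suc (length \<pi>)} = abs ` set (a # \<pi>)"
    using nth_image[of "length (a # \<pi>)" "a # \<pi>"] by simp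
  moreover have "\<bar>a\<bar> = Min (abs ` set (a # \<pi>)) \<longleftrightarrow> (\<forall>y\<in>set \<pi>. \<bar>a\<bar> \<le> \<bar>y\<bar>)"
    by (subst eq_commute, subst Min_eq_iff) auto
  moreover have "(\<lambda>j. \<bar>(a # \<pi>) ! j\<bar>) ` {Suc i..<Suc (length \<pi>)} = (\<lambda>j. \<bar>\<pi> ! j\<bar>) ` {i..<length \<pi>}" for i
    by (simp flip: image_Suc_atLeastLessThan add: image_image)
  ultimately show ?thesis
    unfolding positive_at_suffix_minima_def by (simp add: All_less_Suc2)
qed

text \<open>A letter exceeding all others in absolute value is a suffix minimum only if nothing
  follows it, and it never affects whether an earlier letter is one.\<close>

lemma positive_at_suffix_minima_append_Cons:
  assumes "\<And>y. y \<in> set (u @ v) \<Longrightarrow> \<bar>y\<bar> < \<bar>x\<bar>"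
  shows "positive_at_suffix_minima (u @ x # v) \<longleftrightarrow>
    positive_at_suffix_minima (u @ v) \<and> (v = [] \<longrightarrow> x > 0)"
  using assms
proof (induction u)
  case Nil
  then have "(\<forall>y\<in>set v. \<bar>x\<bar> \<le> \<bar>y\<bar>) \<longleftrightarrow> v = []" by (cases v) fastforce+
  then show ?case by (auto simp: positive_at_suffix_minima_Cons)
next
  case (Cons a u)
  then have "\<bar>a\<bar> \<le> \<bar>x\<bar>" by (simp add: less_imp_le)
  with Cons show ?case by (simp add: positive_at_suffix_minima_Cons ball_Un)
qed

lemma positive_at_suffix_minima_ins:
  assumes "\<And>y. y \<in> set \<pi> \<Longrightarrow> \<bar>y\<bar> < \<bar>x\<bar>" and "i \<le> length \<pi>"
  shows "positive_at_suffix_minima (ins i x \<pi>) \<longleftrightarrow>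
    positive_at_suffix_minima \<pi> \<and> (i = length \<pi> \<longrightarrow> x > 0)"
  using positive_at_suffix_minima_append_Cons[of "take i \<pi>" "drop i \<pi>" x] assms
  by (auto simp: ins_def)

section \<open>Gluing bijections of fibres\<close>

text \<open>Fibres over a common value are finite of equal size. Bijections chosen value by value
  glue together, since the fibres partition \<open>A\<close> and \<open>B\<close>.\<close>

lemma bij_betw_from_card_fibres:
  assumes "finite A" "finite B"
    and card: "\<And>s. card {x \<in> A. f x = s} = card {y \<in> B. g y = s}"
  shows "\<exists>h. bij_betw h A B \<and> (\<forall>x\<in>A. g (h x) = f x)"
proof -
  have "\<forall>s. \<exists>h. bij_betw h {x \<in> A. f x = s} {y \<in> B. g y = s}"
    using assms by (intro allI finite_same_card_bij) auto
  then obtain H where H: "\<And>s. bij_betw (H s) {x \<in> A. f x = s} {y \<in> B. g y = s}"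
    by metis
  define h where "h x = H (f x) x" for x
  have h: "h x \<in> B" "g (h x) = f x" if "x \<in> A" for x
    using bij_betw_apply[OF H, of x "f x"] that by (auto simp: h_def)
  have "inj_on h A"
  proof (rule inj_onI)
    fix x y assume xy: "x \<in> A" "y \<in> A" "h x = h y"
    then have "f x = f y" using h(2) by metis
    then show "x = y"
      using bij_betw_imp_inj_on[OF H[of "f x"]] xy by (auto simp: h_def inj_on_def)
  qed
  moreover have "y \<in> h ` A" if "y \<in> B" for y
  proof -
    have "y \<in> H (g y) ` {x \<in> A. f x = g y}"
      using bij_betw_imp_surj_on[OF H[of "g y"]] that by blast
    then obtain x where "x \<in> A" "f x = g y" "y = H (g y) x" by blast
    then show ?thesis by (intro image_eqI[of _ _ x]) (simp_all add: h_def)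
  qed
  ultimately show ?thesis using h by (auto simp: bij_betw_def)
qed

section \<open>Parents and children under insertion\<close>

lemma good_signed_permsD:
  assumes "\<pi> \<in> good_signed_perms e n"
  shows "length \<pi> = n" and "good e (abs_word \<pi>)" and "set (abs_word \<pi>) = {1..n}"
    and "distinct (abs_word \<pi>)" and "y \<in> set \<pi> \<Longrightarrow> \<bar>y\<bar> \<le> int n"
proof -
  have perm: "set (abs_word \<pi>) = {1..n}" "distinct (abs_word \<pi>)"
    using assms by (auto simp: good_signed_perms_def permutations_of_set_def)
  then show "set (abs_word \<pi>) = {1..n}" "distinct (abs_word \<pi>)" by auto
  show len: "length \<pi> = n" using perm by (metis card_atLeastAtMost diff_Suc_1 distinct_card length_abs_word)
  show "good e (abs_word \<pi>)"
  \<comment> \<open>For \<open>n = 0\<close> the condition on subwords is vacuous and says nothing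
    of the empty word; otherwise the word is its own subword for \<open>k = n\<close>.\<close>
  proof (cases "n = 0")
    case True
    then show ?thesis using len by (simp add: good_def descents_def)
  next
    case False
    then have "good e (subword (abs_word \<pi>) n)" using assms by (simp add: good_signed_perms_def)
    moreover have "subword (abs_word \<pi>) n = abs_word \<pi>"
      using perm by (simp add: subword_def)
    ultimately show ?thesis by simp
  qed
  assume "y \<in> set \<pi>"
  then have "nat \<bar>y\<bar> \<in> set (abs_word \<pi>)" by (simp add: abs_word_def)
  then show "\<bar>y\<bar> \<le> int n" using perm by auto
qed

text \<open>Each pair, a position and a signed letter, stands for one child of \<pi>: the new letter
  is appended with positive sign, or inserted at a site with either sign.\<close>

definition slots :: "nat \<Rightarrow> nat \<Rightarrow> int list \<Rightarrow> (nat \<times> int) set" where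
  "slots e n \<pi> = insert (n, int (Suc n)) (sites e (abs_word \<pi>) \<times> {int (Suc n), - int (Suc n)})"

lemma slotsD:
  assumes "\<pi> \<in> good_signed_perms e n" and "(i, x) \<in> slots e n \<pi>"
  shows "i \<le> n" and "\<bar>x\<bar> = int (Suc n)"
  using assms good_signed_permsD(1)[OF assms(1)] by (auto simp: slots_def sites_def)

text \<open>The subwords for \<open>k \<le> n\<close> do not see the new letter, so only the whole
  word and the sign condition have to be compared with those of the parent.\<close>

lemma ins_mem_good_signed_perms_iff:
  assumes i: "i \<le> length \<pi>" and x: "\<bar>x\<bar> = int (Suc n)"
  shows "ins i x \<pi> \<in> good_signed_perms e (Suc n) \<longleftrightarrow>
    \<pi> \<in> good_signed_perms e n \<and> (i, x) \<in> slots e n \<pi>"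
proof -
  let ?w = "abs_word \<pi>"
  have aw: "abs_word (ins i x \<pi>) = ins i (Suc n) ?w" by (simp only: abs_word_ins x nat_int)
  have perm: "ins i (Suc n) ?w \<in> permutations_of_set {1..Suc n} \<longleftrightarrow> ?w \<in> permutations_of_set {1..n}"
  proof -
    have "Suc n \<notin> A \<Longrightarrow> insert (Suc n) A = {1..Suc n} \<longleftrightarrow> A = {1..n}" for A
      by (subst atLeastAtMostSuc_conv) (simp, subst insert_ident, simp_all)
    moreover have "Suc n \<notin> {1..n}" by simp
    ultimately show ?thesis
      unfolding permutations_of_set_def mem_Collect_eq set_ins distinct_ins by blast
  qed
  show ?thesis
  proof (cases "?w \<in> permutations_of_set {1..n}")
    case False
    then show ?thesis using perm aw by (auto simp: good_signed_perms_def)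
  next
    case True
    then have set: "set ?w = {1..n}" and dist: "distinct ?w" by (auto simp: permutations_of_set_def)
    then have len: "length \<pi> = n"
      by (metis card_atLeastAtMost diff_Suc_1 distinct_card length_abs_word)
    have lt: "y < Suc n" if "y \<in> set ?w" for y using that set by auto
    have abs_lt: "\<bar>y\<bar> < \<bar>x\<bar>" if "y \<in> set \<pi>" for y
    proof -
      have "nat \<bar>y\<bar> \<in> set ?w" using that by (simp add: abs_word_def)
      then show ?thesis using lt x by fastforce
    qed
    have sub: "subword (ins i (Suc n) ?w) k = subword ?w k" if "k \<le> n" for k
      using that by (simp add: subword_def filter_ins)
    have top: "subword (ins i (Suc n) ?w) (Suc n) = ins i (Suc n) ?w"
    proof -
      have "\<forall>y\<in>set (ins i (Suc n) ?w). y \<le> Suc n"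
        using lt by (auto intro: less_imp_le)
      then show ?thesis unfolding subword_def by (simp del: set_ins add: filter_id_conv)
    qed
    have split: "(\<forall>k\<in>{1..Suc n}. Q k) \<longleftrightarrow> (\<forall>k\<in>{1..n}. Q k) \<and> Q (Suc n)" for Q
      unfolding atLeastAtMostSuc_conv[OF Suc_le_mono[THEN iffD2, OF le0], folded One_nat_def] by blast
    have "ins i x \<pi> \<in> good_signed_perms e (Suc n) \<longleftrightarrow>
      (\<forall>k\<in>{1..n}. good e (subword ?w k)) \<and> good e (ins i (Suc n) ?w) \<and>
      positive_at_suffix_minima \<pi> \<and> (i = n \<longrightarrow> x > 0)"
      unfolding good_signed_perms_def mem_Collect_eq aw split
      using True perm sub top positive_at_suffix_minima_ins[OF abs_lt i] len by auto
    also have "\<dots> \<longleftrightarrow> \<pi> \<in> good_signed_perms e n \<and> good e (ins i (Suc n) ?w) \<and> (i = n \<longrightarrow> x > 0)"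
      using True by (auto simp: good_signed_perms_def)
    also have "\<dots> \<longleftrightarrow> \<pi> \<in> good_signed_perms e n \<and> (i, x) \<in> slots e n \<pi>"
    proof (rule conj_cong[OF refl])
      assume "\<pi> \<in> good_signed_perms e n"
      then have good: "good e ?w" by (rule good_signed_permsD)
      show "good e (ins i (Suc n) ?w) \<and> (i = n \<longrightarrow> x > 0) \<longleftrightarrow> (i, x) \<in> slots e n \<pi>"
      proof (cases "i = n")
        case True
        \<comment> \<open>Hence the pair can be a slot only as the appended one, which carries the
          positive sign.\<close>
        then have "i \<notin> sites e ?w" using len by (auto simp: sites_def)
        moreover have "ins i (Suc n) ?w = ?w @ [Suc n]" using True len by (metis ins_length length_abs_word)
        ultimately show ?thesis using good_snoc[OF lt good] True x by (auto simp: slots_def)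
      next
        case False
        then have "i < length ?w" using i len by simp
        then show ?thesis using good_ins_iff[OF lt _ good, of i] False x by (auto simp: slots_def)
      qed
    qed
    finally show ?thesis .
  qed
qed

text \<open>Deleting the letter of largest absolute value recovers the parent, and its place and
  sign recover the slot.\<close>

lemma good_signed_perms_Suc:
  "bij_betw (\<lambda>(\<pi>, i, x). ins i x \<pi>) (SIGMA \<pi>:good_signed_perms e n. slots e n \<pi>)
     (good_signed_perms e (Suc n))"
  (is "bij_betw ?f ?A ?B")
  unfolding bij_betw_def
proof
  show "inj_on ?f ?A"
  proof (rule inj_onI, clarsimp)
    fix \<pi> i x \<pi>' i' x'
    assume *: "\<pi> \<in> good_signed_perms e n" "(i, x) \<in> slots e n \<pi>"
      "\<pi>' \<in> good_signed_perms e n" "(i', x') \<in> slots e n \<pi>'" and eq: "ins i x \<pi> = ins i' x' \<pi>'"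
    \<comment> \<open>\<open>?P\<close> tells old letters from the new one: filtering by it returns
      the parent, and the longest prefix satisfying it has the insertion position as its
      length.\<close>
    let ?P = "\<lambda>y. \<bar>y\<bar> \<le> int n"
    have P: "filter ?P (ins i x \<pi>) = \<pi>" "length (takeWhile ?P (ins i x \<pi>)) = i"
      "ins i x \<pi> ! i = x"
      if "\<pi> \<in> good_signed_perms e n" "(i, x) \<in> slots e n \<pi>" for \<pi> i x
    proof -
      note \<pi> = good_signed_permsD(1,5)[OF that(1)] and s = slotsD[OF that]
      show "filter ?P (ins i x \<pi>) = \<pi>" using \<pi> s by (simp add: filter_ins filter_id_conv)
      have "takeWhile ?P (take i \<pi> @ x # drop i \<pi>) = take i \<pi>"
        using \<pi>(2) s by (subst takeWhile_append2) (auto dest: in_set_takeD)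
      then show "length (takeWhile ?P (ins i x \<pi>)) = i" using \<pi> s by (simp add: ins_def)
      show "ins i x \<pi> ! i = x" using \<pi> s by (simp add: nth_ins)
    qed
    show "\<pi> = \<pi>' \<and> i = i' \<and> x = x'"
      using P[OF *(1,2)] P[OF *(3,4)] eq by metis
  qed
  show "?f ` ?A = ?B"
  proof
    show "?f ` ?A \<subseteq> ?B"
    proof clarify
      fix \<pi> i x assume *: "\<pi> \<in> good_signed_perms e n" "(i, x) \<in> slots e n \<pi>"
      then have "i \<le> length \<pi>" using slotsD(1) good_signed_permsD(1) by metis
      then show "ins i x \<pi> \<in> ?B"
        using ins_mem_good_signed_perms_iff[OF _ slotsD(2)[OF *]] * by blast
    qed
    show "?B \<subseteq> ?f ` ?A"
    proof
      fix \<sigma> assume \<sigma>: "\<sigma> \<in> ?B"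
      then have "Suc n \<in> set (abs_word \<sigma>)" by (simp add: good_signed_permsD(3))
      then obtain x where x: "x \<in> set \<sigma>" "nat \<bar>x\<bar> = Suc n" by (auto simp: abs_word_def)
      then obtain u v where uv: "\<sigma> = u @ x # v" by (meson split_list)
      have ins: "\<sigma> = ins (length u) x (u @ v)" by (simp add: uv ins_def)
      have "u @ v \<in> good_signed_perms e n \<and> (length u, x) \<in> slots e n (u @ v)"
        using \<sigma> x(2) unfolding ins by (subst (asm) ins_mem_good_signed_perms_iff) auto
      then show "\<sigma> \<in> ?f ` ?A" using ins by force
    qed
  qed
qed

lemma finite_slots [simp]: "finite (slots e n \<pi>)"
  by (simp add: slots_def sites_def)

lemma finite_good_signed_perms [simp]: "finite (good_signed_perms e n)"
proof (induction n)
  case 0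
  have "good_signed_perms e 0 \<subseteq> {[]}" using good_signed_permsD(1)[of _ e 0] by auto
  then show ?case by (rule finite_subset) simp
next
  case (Suc n)
  then show ?case using bij_betw_finite[OF good_signed_perms_Suc[of e n]] by simp
qed

section \<open>Counting children by statistic\<close>

text \<open>The terms count appending, sites inside a descent and all other sites; the factor 2 is
  the choice of sign. With \<open>m\<close> the word length minus \<open>e\<close>, the appended
  letter \<open>m + e + 1\<close> has shifted value \<open>Suc m\<close>, so the rule no longer
  mentions \<open>e\<close>.\<close>

definition child_count :: "nat \<Rightarrow> nat \<times> int \<Rightarrow> nat \<times> int \<Rightarrow> nat" where
  "child_count m = (\<lambda>(d, l) s. of_bool (s = (d, int (Suc m))) + 2 * d * of_bool (s = (d, l))
     + 2 * (m - 2 * d) * of_bool (s = (Suc d, l)))"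

lemma card_children:
  assumes \<pi>: "\<pi> \<in> good_signed_perms e (m + e)"
  shows "card {t \<in> slots e (m + e) \<pi>. stat e (case t of (i, x) \<Rightarrow> ins i x \<pi>) = s} =
    child_count m (stat e \<pi>) s"
proof -
  let ?n = "m + e" and ?w = "abs_word \<pi>"
  let ?D = "Suc ` descents ?w" and ?X = "{int (Suc (m + e)), - int (Suc (m + e))}"
  note D = good_signed_permsD[OF \<pi>]
  have lt: "y < Suc ?n" if "y \<in> set ?w" for y using that D(3) by auto
  \<comment> \<open>An indicator of the statistic \<open>s\<close>, so that counting children
    becomes a sum over slots.\<close>
  define g :: "nat \<times> int \<Rightarrow> nat" where
    "g t = of_bool (stat e (case t of (i, x) \<Rightarrow> ins i x \<pi>) = s)" for t
  obtain d l where dl: "stat e \<pi> = (d, l)" by fastforce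
  then have d: "d = card (descents ?w)" and l: "l = Last \<pi> - int e" by (auto simp: stat_def)
  have g_end: "g (?n, int (Suc ?n)) = of_bool (s = (d, int (Suc m)))"
  proof -
    have "ins ?n (int (Suc ?n)) \<pi> = \<pi> @ [int (Suc ?n)]" using D(1) by (metis ins_length)
    moreover have "abs_word (\<pi> @ [int (Suc ?n)]) = ?w @ [Suc ?n]" by (simp add: abs_word_def)
    ultimately show ?thesis
      using descents_snoc[OF lt] d by (auto simp: g_def stat_def Last_def)
  qed
  have g_site: "g (i, x) = of_bool (s = (if i \<in> ?D then d else Suc d, l))"
    if i: "i \<in> sites e ?w" and x: "x \<in> ?X" for i x
  proof -
    have i_lt: "i < length ?w" using i by (auto simp: sites_def)
    then have "Last (ins i x \<pi>) = Last \<pi>" by (auto simp: Last_def ins_def)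
    moreover have "nat \<bar>x\<bar> = Suc ?n" using x by auto
    ultimately show ?thesis
      using card_descents_ins[OF lt i_lt] d l
      by (auto simp: g_def stat_def abs_word_ins)
  qed
  note sites = card_sites[OF D(2)]
  have fin: "finite (sites e ?w)" by (simp add: sites_def)
  have "(?n, int (Suc ?n)) \<notin> sites e ?w \<times> ?X" using D(1) by (simp add: sites_def)
  then have "sum g (slots e ?n \<pi>) = g (?n, int (Suc ?n)) + sum g (sites e ?w \<times> ?X)"
    using fin by (simp add: slots_def)
  also have "sum g (sites e ?w \<times> ?X) = (\<Sum>i\<in>sites e ?w. \<Sum>x\<in>?X. g (i, x))"
    by (subst sum.cartesian_product) (simp add: case_prod_eta)
  also have "\<dots> = (\<Sum>i\<in>sites e ?w. 2 * of_bool (s = (if i \<in> ?D then d else Suc d, l)))"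
    
  proof (intro sum.cong refl)
    fix i assume "i \<in> sites e ?w"
    then have "(\<Sum>x\<in>?X. g (i, x)) = (\<Sum>x\<in>?X. of_bool (s = (if i \<in> ?D then d else Suc d, l)))"
      by (intro sum.cong refl g_site)
    also have "\<dots> = card ?X * of_bool (s = (if i \<in> ?D then d else Suc d, l))"
      by (simp only: sum_constant of_nat_id)
    also have "card ?X = 2" by (subst card_2_iff') auto
    finally show "(\<Sum>x\<in>?X. g (i, x)) = 2 * of_bool (s = (if i \<in> ?D then d else Suc d, l))" .
  qed
  also have "\<dots> = (\<Sum>i\<in>sites e ?w - ?D. 2 * of_bool (s = (Suc d, l)))
      + (\<Sum>i\<in>?D. 2 * of_bool (s = (d, l)))"
    unfolding sum.subset_diff[OF sites(1) fin]
    by (intro arg_cong2[where f = "(+)"] sum.cong refl) auto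
  also have "\<dots> = 2 * (m - 2 * d) * of_bool (s = (Suc d, l)) + 2 * d * of_bool (s = (d, l))"
    using sites(2) D(1) d by (simp add: card_image)
  finally have "sum g (slots e ?n \<pi>) = child_count m (stat e \<pi>) s"
    unfolding child_count_def dl g_end by simp
  moreover have "card {t \<in> slots e ?n \<pi>. stat e (case t of (i, x) \<Rightarrow> ins i x \<pi>) = s} = sum g (slots e ?n \<pi>)"
    by (simp add: g_def sum_of_bool_eq Int_def)
  ultimately show ?thesis by simp
qed

text \<open>Every child has exactly one parent, and a parent contributes through its statistic
  alone. Hence the distribution of \<open>stat\<close> on one level determines that on the
  next.\<close>

lemma card_good_signed_perms_Suc:
  "card {\<sigma> \<in> good_signed_perms e (Suc (m + e)). stat e \<sigma> = s} =
   (\<Sum>\<pi>\<in>good_signed_perms e (m + e). child_count m (stat e \<pi>) s)"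
proof -
  let ?G = "good_signed_perms e (m + e)" and ?f = "\<lambda>(\<pi>, i, x). ins i x \<pi>"
  let ?T = "\<lambda>\<pi>. {t \<in> slots e (m + e) \<pi>. stat e (case t of (i, x) \<Rightarrow> ins i x \<pi>) = s}"
  note bij = good_signed_perms_Suc[of e "m + e"]
  have "{\<sigma> \<in> good_signed_perms e (Suc (m + e)). stat e \<sigma> = s} = ?f ` (SIGMA \<pi>:?G. ?T \<pi>)"
    unfolding bij_betw_imp_surj_on[OF bij, symmetric] by force
  moreover have "inj_on ?f (SIGMA \<pi>:?G. ?T \<pi>)"
    by (rule inj_on_subset[OF bij_betw_imp_inj_on[OF bij]]) auto
  ultimately have "card {\<sigma> \<in> good_signed_perms e (Suc (m + e)). stat e \<sigma> = s} = card (SIGMA \<pi>:?G. ?T \<pi>)"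
    by (simp add: card_image)
  also have "\<dots> = (\<Sum>\<pi>\<in>?G. card (?T \<pi>))" by (simp add: card_SigmaI)
  also have "\<dots> = (\<Sum>\<pi>\<in>?G. child_count m (stat e \<pi>) s)"
    by (intro sum.cong refl card_children)
  finally show ?thesis .
qed

section \<open>The bijection, by induction on the length\<close>

lemma good_signed_perms_0: "good_signed_perms e 0 = {[]}"
  by (auto simp: good_signed_perms_def abs_word_def)

lemma good_signed_perms_1: "good_signed_perms 1 1 = {[1]}"
proof -
  \<comment> \<open>Truncated subtraction gives \<open>0 - 1 = 0\<close>, so the empty word has no
    sites and 1 can only be appended.\<close>
  have "slots 1 0 [] = {(0, 1)}" by (simp add: slots_def sites_def)
  then show ?thesis
    using bij_betw_imp_surj_on[OF good_signed_perms_Suc[of 1 0]]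
    by (simp add: good_signed_perms_0 ins_def Sigma_def)
qed

text \<open>The bijection of the previous level serves only to equate two sums of
  \<open>child_count\<close>; the next one is chosen afresh from the equal fibre sizes.\<close>

lemma stat_preserving_bijection:
  "\<exists>\<phi>. bij_betw \<phi> (good_signed_perms 1 (Suc m)) (good_signed_perms 0 m) \<and>
    (\<forall>\<sigma>\<in>good_signed_perms 1 (Suc m). stat 0 (\<phi> \<sigma>) = stat 1 \<sigma>)"
proof (induction m)
  case 0
  \<comment> \<open>Both sides are \<open>(0, 0)\<close>: the empty word has last letter 0 by
    convention, and the 1 is shifted down.\<close>
  have "stat 0 [] = stat 1 [1]" by (simp add: stat_def Last_def descents_def)
  then show ?case
    using good_signed_perms_1 by (intro exI[of _ "\<lambda>_. []"]) (simp add: good_signed_perms_0 bij_betw_def)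
next
  case (Suc m)
  then obtain \<phi> where \<phi>: "bij_betw \<phi> (good_signed_perms 1 (Suc m)) (good_signed_perms 0 m)"
    "\<And>\<sigma>. \<sigma> \<in> good_signed_perms 1 (Suc m) \<Longrightarrow> stat 0 (\<phi> \<sigma>) = stat 1 \<sigma>" by blast
  have "card {\<sigma> \<in> good_signed_perms 1 (Suc (Suc m)). stat 1 \<sigma> = s} =
        card {\<sigma> \<in> good_signed_perms 0 (Suc m). stat 0 \<sigma> = s}" for s
  proof -
    have "card {\<sigma> \<in> good_signed_perms 1 (Suc (Suc m)). stat 1 \<sigma> = s} =
        (\<Sum>\<sigma>\<in>good_signed_perms 1 (Suc m). child_count m (stat 1 \<sigma>) s)"
      using card_good_signed_perms_Suc[of 1 m s] by simp
    also have "\<dots> = (\<Sum>\<sigma>\<in>good_signed_perms 1 (Suc m). child_count m (stat 0 (\<phi> \<sigma>)) s)"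
      by (intro sum.cong refl) (simp add: \<phi>(2))
    also have "\<dots> = (\<Sum>\<tau>\<in>good_signed_perms 0 m. child_count m (stat 0 \<tau>) s)"
      by (rule sum.reindex_bij_betw[OF \<phi>(1)])
    also have "\<dots> = card {\<sigma> \<in> good_signed_perms 0 (Suc m). stat 0 \<sigma> = s}"
      using card_good_signed_perms_Suc[of 0 m s] by simp
    finally show ?thesis .
  qed
  then show ?case by (intro bij_betw_from_card_fibres) simp_all
qed

section \<open>Identification with Andre and Simsun words\<close>

lemma good_0_iff: "good 0 w \<longleftrightarrow> \<not> has_double_descent w"
  by (auto simp: good_def has_double_descent_def descents_def)

text \<open>Distinct letters make a final step that is not a descent a strict ascent. The extra unit
  in the length condition of \<open>good\<close> excludes just the last possible descent.\<close>

lemma good_1_iff: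
  assumes "distinct w"
  shows "good 1 w \<longleftrightarrow> \<not> has_double_descent w \<and> ends_with_ascent w"
proof (cases "length w \<ge> 2")
  case True
  then obtain l where l: "length w = Suc (Suc l)" by (metis add_2_eq_Suc le_Suc_ex)
  then have "w ! l \<noteq> w ! Suc l" using assms by (simp add: nth_eq_iff_index_eq)
  then have "ends_with_ascent w \<longleftrightarrow> l \<notin> descents w"
    using l by (auto simp: ends_with_ascent_def descents_def)
  moreover have "good 1 w \<longleftrightarrow> good 0 w \<and> l \<notin> descents w"
  proof -
    have "i < Suc l" if "i \<in> descents w" for i using that l by (simp add: descents_def)
    then have "Suc i + 0 < length w" "Suc i + 1 < length w \<longleftrightarrow> i \<noteq> l" if "i \<in> descents w" for i
      using that l by force+
    then show ?thesis unfolding good_def by blast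
  qed
  ultimately show ?thesis using good_0_iff by blast
next
  case False
  then show ?thesis
    by (auto simp: good_def descents_def has_double_descent_def ends_with_ascent_def)
qed

lemma signed_simsun_eq: "signed_simsun n = good_signed_perms 0 n"
  by (auto simp: signed_simsun_def signed_perms_def simsun_perms_def good_signed_perms_def good_0_iff)

lemma hetyei_andre_eq: "hetyei_andre n = good_signed_perms 1 n"
proof -
  have "distinct (subword w k)" if "w \<in> permutations_of_set {1..n}" for w k
    using that by (simp add: subword_def permutations_of_set_def)
  then have "good 1 (subword w k) \<longleftrightarrow>
      \<not> has_double_descent (subword w k) \<and> ends_with_ascent (subword w k)"
    if "w \<in> permutations_of_set {1..n}" for w k
    using that by (intro good_1_iff)
  then show ?thesis
    unfolding hetyei_andre_def signed_perms_def andre_perms_def good_signed_perms_def by auto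
qed

theorem theorem2p12:
  fixes n :: nat
  assumes "n \<ge> 1"
  shows "\<exists>\<phi>. bij_betw \<phi> (hetyei_andre n) (signed_simsun (n - 1))
    \<and> (\<forall>\<sigma>\<in>hetyei_andre n. Last \<sigma> - 1 = Last (\<phi> \<sigma>))
    \<and> (\<forall>k::int. bij_betw \<phi> {\<sigma> \<in> hetyei_andre n. Last \<sigma> = k}
                            {\<tau> \<in> signed_simsun (n - 1). Last \<tau> = k - 1})"
proof -
  obtain m where n: "n = Suc m" using assms by (cases n) auto
  obtain \<phi> where bij: "bij_betw \<phi> (hetyei_andre n) (signed_simsun (n - 1))"
    and stat: "\<forall>\<sigma>\<in>hetyei_andre n. stat 0 (\<phi> \<sigma>) = stat 1 \<sigma>"
    using stat_preserving_bijection[of m] by (auto simp: n hetyei_andre_eq signed_simsun_eq)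
  have last: "\<forall>\<sigma>\<in>hetyei_andre n. Last \<sigma> - 1 = Last (\<phi> \<sigma>)"
    using stat by (simp add: stat_def)
  have "bij_betw \<phi> {\<sigma> \<in> hetyei_andre n. Last \<sigma> = k} {\<tau> \<in> signed_simsun (n - 1). Last \<tau> = k - 1}" for k
  proof (rule bij_betw_subset[OF bij])
    \<comment> \<open>As \<phi> is onto and lowers the last letter by exactly one, every preimage of
      a word ending in \<open>k - 1\<close> ends in \<open>k\<close>.\<close>
    show "\<phi> ` {\<sigma> \<in> hetyei_andre n. Last \<sigma> = k} = {\<tau> \<in> signed_simsun (n - 1). Last \<tau> = k - 1}"
      unfolding bij_betw_imp_surj_on[OF bij, symmetric] using last by force
  qed auto
  with bij last show ?thesis by blast
qed

end
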